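(* Let $f(x,y) = f_2 x^2 + f_1 xy + f_0 y^2$ be a binary quadratic form with integer coefficients $f_2, f_1, f_0$ which is primitive and irreducible. Then every integer $h$ that is representable by $f$ is essentially represented by $f$; that is, for every integer $h$ and all $(x,y), (u,v) \in \mathbb{Z}^2$ with $f(x,y) = f(u,v) = h$, there exists $T \in \operatorname{Aut}_{\mathbb{Q}} f$ such that $\binom{x}{y} = T\binom{u}{v}$.
   Context: A binary quadratic form $f(x,y) = f_2 x^2 + f_1 xy + f_0 y^2$ with $f_i \in \mathbb{Z}$ is primitive if $\gcd(f_2,f_1,f_0) = 1$, and irreducible if it is irreducible as a polynomial over $\mathbb{Q}$. An integer $h$ is representable by $f$ if there exist integers $x,y$ with $f(x,y) = h$. The rational automorphism group is $\operatorname{Aut}_{\mathbb{Q}} f = \{ T = \left(\begin{smallmatrix} t_1 & t_2 \\ t_3 & t_4\end{smallmatrix}\right) \in \operatorname{GL}_2(\mathbb{Q}) : f(x,y) = f(t_1 x + t_2 y, t_3 x + t_4 y)\}$. A representable integer $h$ is called essentially represented if whenever $(x,y),(u,v) \in \mathbb{Z}^2$ satisfy $f(x,y) = f(u,v) = h$, there exists $T \in \operatorname{Aut}_{\mathbb{Q}} f$ with $\binom{x}{y} = T\binom{u}{v}$. *)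

theory Defs
  imports
    "HOL-Analysis.Determinants"
    "HOL-Computational_Algebra.Polynomial_Factorial"
begin

datatype bqf = BQF (coeff2: int) (coeff1: int) (coeff0: int)

text \<open>The arguments range over an arbitrary commutative ring, so that a form can be evaluated
  at integers and substituted into at polynomials alike.\<close>

definition bqf_eval :: "bqf \<Rightarrow> 'a::comm_ring_1 \<Rightarrow> 'a \<Rightarrow> 'a" where
  "bqf_eval f x y = of_int (coeff2 f) * x ^ 2 + of_int (coeff1 f) * x * y + of_int (coeff0 f) * y ^ 2"

text \<open>The polynomial ring $\mathbb{Q}[x,y]$ is rendered as $\mathbb{Q}[x][y]$:
  the indeterminate $y$ is the outer one, and rational constants are doubly embedded.\<close>

definition varX :: "rat poly poly" where
  "varX = [:[:0, 1:]:]"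

definition varY :: "rat poly poly" where
  "varY = [:0, 1:]"

definition const2 :: "rat \<Rightarrow> rat poly poly" where
  "const2 c = [:[:c:]:]"

definition bqf_primitive :: "bqf \<Rightarrow> bool" where
  "bqf_primitive f \<longleftrightarrow> Gcd {coeff2 f, coeff1 f, coeff0 f} = 1"

definition bqf_irreducible :: "bqf \<Rightarrow> bool" where
  "bqf_irreducible f \<longleftrightarrow> irreducible (bqf_eval f varX varY)"

definition representable :: "bqf \<Rightarrow> int \<Rightarrow> bool" where
  "representable f h \<longleftrightarrow> (\<exists>x y :: int. bqf_eval f x y = h)"

text \<open>Invariance is an identity of polynomials in $\mathbb{Q}[x,y]$.\<close>

definition AutQ :: "bqf \<Rightarrow> (rat ^ 2 ^ 2) set" where
  "AutQ f = {T. invertible T \<and>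
     bqf_eval f varX varY =
     bqf_eval f (const2 (T $ 1 $ 1) * varX + const2 (T $ 1 $ 2) * varY)
                (const2 (T $ 2 $ 1) * varX + const2 (T $ 2 $ 2) * varY)}"

definition essentially_represented :: "bqf \<Rightarrow> int \<Rightarrow> bool" where
  "essentially_represented f h \<longleftrightarrow> representable f h \<and>
     (\<forall>x y u v :: int. bqf_eval f x y = h \<and> bqf_eval f u v = h \<longrightarrow>
       (\<exists>T \<in> AutQ f. (vector [of_int x, of_int y] :: rat ^ 2) = T *v vector [of_int u, of_int v]))"

end

theory Submission
  imports Defs
begin

text \<open>For \<open>f = a x\<^sup>2 + b x y + c y\<^sup>2\<close> the matrices with rows \<open>(p, - c s)\<close> and
  \<open>(a s, p + b s)\<close> are the multiplications by elements of the quadratic algebra attached to \<open>f\<close>;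
  they scale \<open>f\<close> by their determinant \<open>p\<^sup>2 + b p s + a c s\<^sup>2\<close>. Sending \<open>(u, v)\<close> to \<open>(x, y)\<close> is a
  linear system in \<open>(p, s)\<close> of determinant \<open>f(u, v)\<close>, hence solvable over the rationals when
  \<open>h \<noteq> 0\<close>, and then \<open>f(x, y) = f(u, v)\<close> forces the scaling factor to be \<open>1\<close>. For \<open>h = 0\<close> both
  points are the origin, since a nontrivial zero of \<open>f\<close> would split off a linear factor.\<close>

lemma const2_add: "const2 (p + q) = const2 p + const2 q"
  and const2_uminus: "const2 (- p) = - const2 p"
  and const2_mult: "const2 (p * q) = const2 p * const2 q"
  and const2_one: "const2 1 = 1"
  by (simp_all add: const2_def one_pCons)

lemma const2_power: "const2 (p ^ n) = const2 p ^ n"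
  by (induction n) (simp_all add: const2_one const2_mult)

lemma const2_of_int: "const2 (of_int n) = of_int n"
  by (simp add: const2_def of_int_poly)

lemmas const2_hom = const2_add const2_uminus const2_mult const2_one const2_power const2_of_int

lemma bqf_eval_of_int:
  "bqf_eval f (of_int x) (of_int y) = (of_int (bqf_eval f x y) :: 'a::comm_ring_1)"
  by (simp add: bqf_eval_def)

text \<open>Setting both variables to 0 kills the linear form, while a divisor of 1 cannot vanish
  there.\<close>

lemma linear_form_not_unit: "\<not> const2 p * varX + const2 q * varY dvd 1"
proof
  assume "const2 p * varX + const2 q * varY dvd 1"
  then obtain g where "1 = (const2 p * varX + const2 q * varY) * g"
    by (elim dvdE)
  then have "poly (poly 1 0) 0 = poly (poly ((const2 p * varX + const2 q * varY) * g) 0) 0"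
    by simp
  then show False
    by (simp add: const2_def varX_def varY_def)
qed

lemma linear_forms_product_not_irreducible:
  "\<not> irreducible ((const2 p * varX + const2 q * varY) * (const2 r * varX + const2 s * varY))"
  using linear_form_not_unit by (auto dest: irreducibleD)

lemma bqf_irreducible_anisotropic:
  fixes x y :: int
  assumes irr: "bqf_irreducible f" and zero: "bqf_eval f x y = 0"
  shows "x = 0 \<and> y = 0"
proof (cases "y = 0")
  case True
  have "x = 0"
  proof (rule ccontr)
    assume "x \<noteq> 0"
    with zero True have "coeff2 f = 0"
      by (simp add: bqf_eval_def)
    \<comment> \<open>Without an \<open>x^2\<close> term the form is divisible by
      \<open>y\<close>.\<close>
    then have "bqf_eval f varX varY = (const2 0 * varX + const2 1 * varY) *
        (const2 (of_int (coeff1 f)) * varX + const2 (of_int (coeff0 f)) * varY)"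
      by (simp add: bqf_eval_def const2_of_int const2_one const2_def[of 0] algebra_simps power2_eq_square)
    then show False
      using irr linear_forms_product_not_irreducible unfolding bqf_irreducible_def by metis
  qed
  with True show ?thesis by simp
next
  case False
  \<comment> \<open>Dehomogenising: \<open>r\<close> is a root of \<open>f(t, 1)\<close>, so
    \<open>x - r y\<close> divides the form over the rationals.\<close>
  define r :: rat where "r = of_int x / of_int y"
  have root: "of_int (coeff2 f) * r ^ 2 + of_int (coeff1 f) * r + of_int (coeff0 f) = 0"
  proof -
    have "of_int (bqf_eval f x y) = (0 :: rat)"
      using zero by simp
    then show ?thesis
      using False by (simp add: r_def bqf_eval_def field_simps power2_eq_square)
  qed
  let ?a = "of_int (coeff2 f) :: rat" and ?b = "of_int (coeff1 f) :: rat"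
  have "of_int (coeff0 f) = - r * (?a * r + ?b)"
    using root by (simp add: algebra_simps power2_eq_square)
  \<comment> \<open>Moved into the polynomial ring, the root equation eliminates the last
    coefficient, which makes the factorisation below a plain ring identity.\<close>
  then have c: "of_int (coeff0 f) = - const2 r * (of_int (coeff2 f) * const2 r + of_int (coeff1 f))"
    by (metis const2_hom)
  have "bqf_eval f varX varY = (const2 1 * varX + const2 (- r) * varY) *
      (const2 ?a * varX + const2 (?a * r + ?b) * varY)"
    unfolding bqf_eval_def c by (simp add: const2_hom algebra_simps power2_eq_square)
  then have False
    using irr linear_forms_product_not_irreducible unfolding bqf_irreducible_def by metis
  then show ?thesis ..
qed

text \<open>Multiplicativity of the norm: if \<open>w^2 = b w - a c\<close>, then
  \<open>a f(x, y)\<close> is the norm of \<open>a x + w y\<close>, and the substitution is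
  multiplication by \<open>p + s w\<close>. A general ring allows use both at polynomials and at
  rational points.\<close>

lemma bqf_eval_similitude:
  fixes p s x y :: "'a::comm_ring_1"
  shows "bqf_eval f (p * x + - (of_int (coeff0 f) * s) * y)
      (of_int (coeff2 f) * s * x + (p + of_int (coeff1 f) * s) * y) =
    (p ^ 2 + of_int (coeff1 f) * p * s + of_int (coeff2 f) * of_int (coeff0 f) * s ^ 2) *
      bqf_eval f x y"
  by (simp add: bqf_eval_def algebra_simps power2_eq_square)

lemma norm_one_matrix_in_AutQ:
  fixes p s :: rat
  assumes norm: "p ^ 2 + of_int (coeff1 f) * p * s +
    of_int (coeff2 f) * of_int (coeff0 f) * s ^ 2 = 1"
  shows "(vector [vector [p, - (of_int (coeff0 f) * s)],
    vector [of_int (coeff2 f) * s, p + of_int (coeff1 f) * s]] :: rat ^ 2 ^ 2) \<in> AutQ f"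
    (is "?T \<in> _")
proof -
  have "det ?T = 1"
    using norm by (simp add: det_2 algebra_simps power2_eq_square)
  then have "invertible ?T"
    by (simp add: invertible_det_nz)
  \<comment> \<open>The norm equation among constant polynomials turns the similitude at
    \<open>varX\<close>, \<open>varY\<close> into invariance.\<close>
  moreover have "(const2 p) ^ 2 + of_int (coeff1 f) * const2 p * const2 s +
      of_int (coeff2 f) * of_int (coeff0 f) * (const2 s) ^ 2 = 1"
    using arg_cong[OF norm, of const2] by (simp add: const2_hom)
  ultimately show ?thesis
    using bqf_eval_similitude[of f "const2 p" varX "const2 s" varY]
    by (simp add: AutQ_def const2_hom)
qed

lemma AutQ_transitive_on_nonzero_level:
  fixes x y u v :: rat
  assumes eq: "bqf_eval f x y = bqf_eval f u v" and nz: "bqf_eval f u v \<noteq> 0"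
  shows "\<exists>T \<in> AutQ f. (vector [x, y] :: rat ^ 2) = T *v vector [u, v]"
proof -
  define a b c :: rat
    where "a = of_int (coeff2 f)" and "b = of_int (coeff1 f)" and "c = of_int (coeff0 f)"
  define h where "h = bqf_eval f u v"
  have h: "h = a * u ^ 2 + b * u * v + c * v ^ 2"
    by (simp add: h_def bqf_eval_def a_def b_def c_def)
  \<comment> \<open>Cramer's rule for \<open>p u - c s v = x\<close> and
    \<open>a s u + (p + b s) v = y\<close> in the unknowns \<open>p\<close>,
    \<open>s\<close>.\<close>
  define p s where "p = (x * (a * u + b * v) + c * v * y) / h" and "s = (u * y - v * x) / h"
  have ph: "p * h = x * (a * u + b * v) + c * v * y" and sh: "s * h = u * y - v * x"
    using nz by (simp_all add: p_def s_def h_def)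
  have "h * (p * u + - (c * s) * v) = h * x"
  proof -
    have "h * (p * u + - (c * s) * v) = (p * h) * u - c * (s * h) * v"
      by (simp add: algebra_simps)
    also have "\<dots> = h * x"
      unfolding ph sh unfolding h by (simp add: algebra_simps power2_eq_square)
    finally show ?thesis .
  qed
  then have x: "p * u + - (c * s) * v = x"
    using nz by (simp add: h_def)
  have "h * (a * s * u + (p + b * s) * v) = h * y"
  proof -
    have "h * (a * s * u + (p + b * s) * v) = a * (s * h) * u + (p * h) * v + b * (s * h) * v"
      by (simp add: algebra_simps)
    also have "\<dots> = h * y"
      unfolding ph sh unfolding h by (simp add: algebra_simps power2_eq_square)
    finally show ?thesis .
  qed
  then have y: "a * s * u + (p + b * s) * v = y"
    using nz by (simp add: h_def)
  \<comment> \<open>The similitude at \<open>(u, v)\<close>, whose image is \<open>(x, y)\<close>,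
    another point of value \<open>h\<close>.\<close>
  have "(p ^ 2 + b * p * s + a * c * s ^ 2) * h = h"
    using bqf_eval_similitude[of f p u s v] eq x y
    by (simp add: h_def a_def b_def c_def)
  then have norm: "p ^ 2 + b * p * s + a * c * s ^ 2 = 1"
    using nz by (simp add: h_def)
  let ?T = "vector [vector [p, - (c * s)], vector [a * s, p + b * s]] :: rat ^ 2 ^ 2"
  have "?T \<in> AutQ f"
    using norm_one_matrix_in_AutQ norm unfolding a_def b_def c_def by blast
  moreover have "(vector [x, y] :: rat ^ 2) = ?T *v vector [u, v]"
    using x y by (simp add: vec_eq_iff forall_2 matrix_vector_mult_def sum_2)
  ultimately show ?thesis by blast
qed

lemma mat_1_in_AutQ: "mat 1 \<in> AutQ f"
proof -
  have "invertible (mat 1 :: rat ^ 2 ^ 2)"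
    by (simp add: invertible_det_nz)
  then show ?thesis
    by (simp add: AutQ_def mat_def const2_def flip: one_pCons)
qed

theorem theorem1p1:
  fixes f :: bqf
  assumes "bqf_primitive f" and "bqf_irreducible f"
  shows "\<forall>h :: int. representable f h \<longrightarrow> essentially_represented f h"
proof (intro allI impI)
  fix h :: int
  assume "representable f h"
  moreover have "\<exists>T \<in> AutQ f. (vector [of_int x, of_int y] :: rat ^ 2) = T *v vector [of_int u, of_int v]"
    if xy: "bqf_eval f x y = h" and uv: "bqf_eval f u v = h" for x y u v :: int
  proof (cases "h = 0")
    case True
    then have "x = 0 \<and> y = 0" "u = 0 \<and> v = 0"
      using bqf_irreducible_anisotropic[OF assms(2)] xy uv by blast+
    then show ?thesis
      using mat_1_in_AutQ by (intro bexI[of _ "mat 1"]) simp_all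
  next
    case False
    then show ?thesis
      using xy uv by (intro AutQ_transitive_on_nonzero_level) (simp_all add: bqf_eval_of_int)
  qed
  ultimately show "essentially_represented f h"
    by (auto simp: essentially_represented_def)
qed

end
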